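(* Let $T$ be a Hausdorff topological group, $X$ a compact Hausdorff space, $T\curvearrowright X$ a minimal flow, and $H\in\mathcal S^{\mathrm{ncc}}(T)$. Then $T\curvearrowright X/H$ is an almost periodic nontrivial factor of $T\curvearrowright X$ if and only if $T\curvearrowright X\times T/H$, defined by $(t,(x,sH))\mapsto(tx,tsH)$, is not a minimal flow.
   Context: A flow $T\curvearrowright X$ is a jointly continuous map $T\times X\to X$, $(t,x)\mapsto tx$, with $ex=x$ and $(st)x=s(tx)$. It is minimal if $\overline{Tx}=X$ for all $x\in X$. A subgroup $H$ of $T$ is co-compact if the left-coset space $T/H$ (quotient topology) is compact; $\mathcal S^{\mathrm{ncc}}(T)$ is the family of normal co-compact closed subgroups of $T$. Let $R_H=\{(x,x')\in X\times X\mid x'\in\overline{Hx}\}$, and $X/H:=X/R_H$ with the quotient topology; in the present setting $R_H$ is a closed $T$-invariant equivalence relation on $X$, and $T\curvearrowright X/H$ is the induced flow. A flow $T\curvearrowright Z$ is a factor of $T\curvearrowright X$ if there is a continuous surjection $\phi\colon X\to Z$ with $\phi(tx)=t\phi(x)$ for all $t\in T$, $x\in X$; it is nontrivial if $Z$ is not a singleton. A subset $A\subseteq T$ is syndetic if $T=K^{-1}A$ for some nonempty compact $K\subseteq T$. A flow on a compact Hausdorff space $Z$ with uniformity $\mathscr U$ is almost periodic if for each $\alpha\in\mathscr U$ there is a syndetic set $A\subseteq T$ with $Az\subseteq\alpha[z]$ for all $z\in Z$; equivalently, it is equicontinuous, i.e. for every $\varepsilon\in\mathscr U$ there is $\delta\in\mathscr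 U$ with $T\delta\subseteq\varepsilon$. *)

theory Defs
  imports "HOL-Analysis.Analysis" "HOL-Algebra.Coset"
begin

definition topological_group :: "('g, 'm) monoid_scheme \<Rightarrow> 'g topology \<Rightarrow> bool" where
  "topological_group G T \<longleftrightarrow> group G \<and> topspace T = carrier G \<and>
     continuous_map (prod_topology T T) T (\<lambda>(s, t). s \<otimes>\<^bsub>G\<^esub> t) \<and>
     continuous_map T T (\<lambda>t. inv\<^bsub>G\<^esub> t)"

text \<open>The quotient topology on the image of a map \<open>q\<close>; when \<open>q\<close> sends each point to its
  class, the points of the quotient space are the classes themselves.\<close>

definition quotient_topology :: "'a topology \<Rightarrow> ('a \<Rightarrow> 'b) \<Rightarrow> 'b topology" where
  "quotient_topology X q =
     topology (\<lambda>U. U \<subseteq> q ` topspace X \<and> openin X {x \<in> topspace X. q x \<in> U})"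

lemma openin_quotient_topology:
  "openin (quotient_topology X q) U \<longleftrightarrow>
     U \<subseteq> q ` topspace X \<and> openin X {x \<in> topspace X. q x \<in> U}"
proof -
  have "istopology (\<lambda>U. U \<subseteq> q ` topspace X \<and> openin X {x \<in> topspace X. q x \<in> U})"
  proof (unfold istopology_def, intro conjI allI impI)
    fix S T
    assume S: "S \<subseteq> q ` topspace X \<and> openin X {x \<in> topspace X. q x \<in> S}"
      and T: "T \<subseteq> q ` topspace X \<and> openin X {x \<in> topspace X. q x \<in> T}"
    show "S \<inter> T \<subseteq> q ` topspace X"
      using S by blast
    have "{x \<in> topspace X. q x \<in> S \<inter> T} =
        {x \<in> topspace X. q x \<in> S} \<inter> {x \<in> topspace X. q x \<in> T}"
      by blast
    then show "openin X {x \<in> topspace X. q x \<in> S \<inter> T}"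
      using openin_Int[OF S[THEN conjunct2] T[THEN conjunct2]] by (simp only:)
  next
    fix \<K>
    assume *: "\<forall>K\<in>\<K>. K \<subseteq> q ` topspace X \<and> openin X {x \<in> topspace X. q x \<in> K}"
    then show "\<Union>\<K> \<subseteq> q ` topspace X"
      by blast
    have "openin X (\<Union>((\<lambda>K. {x \<in> topspace X. q x \<in> K}) ` \<K>))"
      by (rule openin_Union) (use * in blast)
    moreover have "{x \<in> topspace X. q x \<in> \<Union>\<K>} = \<Union>((\<lambda>K. {x \<in> topspace X. q x \<in> K}) ` \<K>)"
      by blast
    ultimately show "openin X {x \<in> topspace X. q x \<in> \<Union>\<K>}"
      by (simp only:)
  qed
  then show ?thesis
    unfolding quotient_topology_def by (simp only: topology_inverse')
qed

lemma topspace_quotient_topology: "topspace (quotient_topology X q) = q ` topspace X"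
proof
  show "topspace (quotient_topology X q) \<subseteq> q ` topspace X"
    using openin_quotient_topology[THEN iffD1, OF openin_topspace] by (rule conjunct1)
  have "{x \<in> topspace X. q x \<in> q ` topspace X} = topspace X"
    by blast
  then have "openin (quotient_topology X q) (q ` topspace X)"
    unfolding openin_quotient_topology by (simp only: openin_topspace subset_refl simp_thms)
  then show "q ` topspace X \<subseteq> topspace (quotient_topology X q)"
    by (rule openin_subset)
qed

definition left_coset_space ::
    "('g, 'm) monoid_scheme \<Rightarrow> 'g topology \<Rightarrow> 'g set \<Rightarrow> 'g set topology" where
  "left_coset_space G T H = quotient_topology T (\<lambda>s. s <#\<^bsub>G\<^esub> H)"

definition normal_cocompact_closed_subgroups ::
    "('g, 'm) monoid_scheme \<Rightarrow> 'g topology \<Rightarrow> 'g set set" where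
  "normal_cocompact_closed_subgroups G T =
     {H. H \<lhd> G \<and> closedin T H \<and> compact_space (left_coset_space G T H)}"

definition flow ::
    "('g, 'm) monoid_scheme \<Rightarrow> 'g topology \<Rightarrow> 'x topology \<Rightarrow> ('g \<Rightarrow> 'x \<Rightarrow> 'x) \<Rightarrow> bool" where
  "flow G T X act \<longleftrightarrow>
     continuous_map (prod_topology T X) X (\<lambda>(t, x). act t x) \<and>
     (\<forall>x\<in>topspace X. act \<one>\<^bsub>G\<^esub> x = x) \<and>
     (\<forall>s\<in>carrier G. \<forall>t\<in>carrier G. \<forall>x\<in>topspace X. act (s \<otimes>\<^bsub>G\<^esub> t) x = act s (act t x))"

definition minimal_flow ::
    "('g, 'm) monoid_scheme \<Rightarrow> 'g topology \<Rightarrow> 'x topology \<Rightarrow> ('g \<Rightarrow> 'x \<Rightarrow> 'x) \<Rightarrow> bool" where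
  "minimal_flow G T X act \<longleftrightarrow> flow G T X act \<and>
     (\<forall>x\<in>topspace X. X closure_of ((\<lambda>t. act t x) ` carrier G) = topspace X)"

definition factor_flow ::
    "('g, 'm) monoid_scheme \<Rightarrow> 'g topology \<Rightarrow> 'x topology \<Rightarrow> ('g \<Rightarrow> 'x \<Rightarrow> 'x) \<Rightarrow>
     'z topology \<Rightarrow> ('g \<Rightarrow> 'z \<Rightarrow> 'z) \<Rightarrow> bool" where
  "factor_flow G T X act Z act' \<longleftrightarrow> flow G T X act \<and> flow G T Z act' \<and>
     (\<exists>\<phi>. continuous_map X Z \<phi> \<and> \<phi> ` topspace X = topspace Z \<and>
        (\<forall>t\<in>carrier G. \<forall>x\<in>topspace X. \<phi> (act t x) = act' t (\<phi> x)))"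

definition syndetic :: "('g, 'm) monoid_scheme \<Rightarrow> 'g topology \<Rightarrow> 'g set \<Rightarrow> bool" where
  "syndetic G T A \<longleftrightarrow> A \<subseteq> carrier G \<and>
     (\<exists>K. K \<noteq> {} \<and> compactin T K \<and> carrier G = (set_inv\<^bsub>G\<^esub> K) <#>\<^bsub>G\<^esub> A)"

text \<open>Uniformities on a carrier set, given by their entourages. The library's class
  \<open>uniform_space\<close> lives on whole types, so it does not apply to quotient spaces.\<close>

definition is_uniformity :: "'a set \<Rightarrow> ('a \<times> 'a) set set \<Rightarrow> bool" where
  "is_uniformity S \<U> \<longleftrightarrow> \<U> \<noteq> {} \<and>
     (\<forall>\<alpha>\<in>\<U>. Id_on S \<subseteq> \<alpha> \<and> \<alpha> \<subseteq> S \<times> S) \<and>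
     (\<forall>\<alpha>\<in>\<U>. \<forall>\<beta>. \<alpha> \<subseteq> \<beta> \<and> \<beta> \<subseteq> S \<times> S \<longrightarrow> \<beta> \<in> \<U>) \<and>
     (\<forall>\<alpha>\<in>\<U>. \<forall>\<beta>\<in>\<U>. \<alpha> \<inter> \<beta> \<in> \<U>) \<and>
     (\<forall>\<alpha>\<in>\<U>. \<alpha>\<inverse> \<in> \<U>) \<and>
     (\<forall>\<alpha>\<in>\<U>. \<exists>\<beta>\<in>\<U>. \<beta> O \<beta> \<subseteq> \<alpha>)"

definition uniformity_of :: "'a topology \<Rightarrow> ('a \<times> 'a) set set \<Rightarrow> bool" where
  "uniformity_of Z \<U> \<longleftrightarrow> is_uniformity (topspace Z) \<U> \<and>
     (\<forall>U. openin Z U \<longleftrightarrow> U \<subseteq> topspace Z \<and> (\<forall>z\<in>U. \<exists>\<alpha>\<in>\<U>. \<alpha> `` {z} \<subseteq> U))"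

text \<open>A compact Hausdorff space carries exactly one uniformity inducing its topology, so the
  existential quantifier below just names it.\<close>

definition almost_periodic_flow ::
    "('g, 'm) monoid_scheme \<Rightarrow> 'g topology \<Rightarrow> 'z topology \<Rightarrow> ('g \<Rightarrow> 'z \<Rightarrow> 'z) \<Rightarrow> bool" where
  "almost_periodic_flow G T Z act \<longleftrightarrow>
     flow G T Z act \<and> compact_space Z \<and> Hausdorff_space Z \<and>
     (\<exists>\<U>. uniformity_of Z \<U> \<and>
        (\<forall>\<alpha>\<in>\<U>. \<exists>A. syndetic G T A \<and>
           (\<forall>z\<in>topspace Z. (\<lambda>t. act t z) ` A \<subseteq> \<alpha> `` {z})))"

definition orbit_closure_rel ::
    "'x topology \<Rightarrow> ('g \<Rightarrow> 'x \<Rightarrow> 'x) \<Rightarrow> 'g set \<Rightarrow> ('x \<times> 'x) set" where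
  "orbit_closure_rel X act H =
     {(x, x'). x \<in> topspace X \<and> x' \<in> topspace X \<and> x' \<in> X closure_of ((\<lambda>h. act h x) ` H)}"

definition orbit_closure_space ::
    "'x topology \<Rightarrow> ('g \<Rightarrow> 'x \<Rightarrow> 'x) \<Rightarrow> 'g set \<Rightarrow> 'x set topology" where
  "orbit_closure_space X act H = quotient_topology X (\<lambda>x. orbit_closure_rel X act H `` {x})"

text \<open>The induced action \<open>t[x] = [tx]\<close>: the union of the classes \<open>[tx]\<close>, \<open>x \<in> C\<close>, which all
  coincide when the relation is a \<open>T\<close>-invariant equivalence relation.\<close>

definition induced_action ::
    "'x topology \<Rightarrow> ('g \<Rightarrow> 'x \<Rightarrow> 'x) \<Rightarrow> 'g set \<Rightarrow> 'g \<Rightarrow> 'x set \<Rightarrow> 'x set" where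
  "induced_action X act H t C = (\<Union>x\<in>C. orbit_closure_rel X act H `` {act t x})"

text \<open>The action \<open>(t, (x, sH)) \<mapsto> (tx, tsH)\<close>; note that \<open>t(sH) = tsH\<close> as sets.\<close>

definition coset_product_action ::
    "('g, 'm) monoid_scheme \<Rightarrow> ('g \<Rightarrow> 'x \<Rightarrow> 'x) \<Rightarrow> 'g \<Rightarrow> 'x \<times> 'g set \<Rightarrow> 'x \<times> 'g set" where
  "coset_product_action G act t = (\<lambda>(x, C). (act t x, t <#\<^bsub>G\<^esub> C))"

end

theory Submission
  imports Defs
begin

text \<open>Compactness of \<open>T/H\<close> makes \<open>DM\<close> closed whenever \<open>M\<close> is a closed \<open>H\<close>-invariant set in a flow
  and \<open>D = DH\<close> is closed in \<open>T\<close>. In \<open>X\<close> this shows that the translates of one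
  \<open>H\<close>-minimal set partition \<open>X\<close> into the \<open>H\<close>-orbit closures, in \<open>X \<times> X\<close> that the orbit closure
  relation is closed. Hence \<open>X/H\<close> is always a compact Hausdorff factor on which \<open>H\<close> acts trivially and
  \<open>T\<close> transitively, and such a flow is almost periodic: finitely many translates of \<open>VH\<close> cover
  \<open>T\<close> for every identity neighbourhood \<open>V\<close>. So the theorem reduces to the equivalence of the
  minimality of \<open>X \<times> T/H\<close> with the \<open>H\<close>-minimality of \<open>X\<close>; for one direction apply the closedness
  of \<open>DM\<close> to \<open>T(cl(Hx) \<times> {H})\<close>, for the other note that the fibre of the orbit closure of
  \<open>(x, sH)\<close> over \<open>sH\<close> is \<open>H\<close>-invariant.\<close>

section \<open>Quotient maps, open maps and saturated closed sets\<close>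

lemma quotient_map_quotient_topology: "quotient_map X (quotient_topology X q) q"
  unfolding quotient_map_def by (auto simp: topspace_quotient_topology openin_quotient_topology)

text \<open>Open sets of a product are unions of open boxes, and a box is mapped onto the box of the
  images.\<close>

lemma open_map_map_prod:
  assumes f: "open_map X X' f" and g: "open_map Y Y' g"
  shows "open_map (prod_topology X Y) (prod_topology X' Y') (\<lambda>(x, y). (f x, g y))"
  unfolding open_map_def
proof (intro allI impI)
  fix U assume U: "openin (prod_topology X Y) U"
  show "openin (prod_topology X' Y') ((\<lambda>(x, y). (f x, g y)) ` U)"
    unfolding openin_prod_topology_alt
  proof (intro allI impI)
    fix x' y' assume "(x', y') \<in> (\<lambda>(x, y). (f x, g y)) ` U"
    then obtain x y where xy: "(x, y) \<in> U" "x' = f x" "y' = g y" by auto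
    with U obtain V W where "openin X V" "openin Y W" "x \<in> V" "y \<in> W" "V \<times> W \<subseteq> U"
      unfolding openin_prod_topology_alt by meson
    moreover from this have "openin X' (f ` V)" "openin Y' (g ` W)"
      using f g by (auto simp: open_map_def)
    ultimately show "\<exists>V W. openin X' V \<and> openin Y' W \<and> x' \<in> V \<and> y' \<in> W \<and>
        V \<times> W \<subseteq> (\<lambda>(x, y). (f x, g y)) ` U"
      using xy by (intro exI[of _ "f ` V"] exI[of _ "g ` W"]) force
  qed
qed

text \<open>For a saturated set the complement of the image is the image of the complement, so
  openness and surjectivity of \<open>f\<close> suffice.\<close>

lemma open_map_image_closedin:
  assumes "open_map X Y f" "f ` topspace X = topspace Y" "closedin X E"
    and sat: "\<And>x y. \<lbrakk>x \<in> E; y \<in> topspace X; f y = f x\<rbrakk> \<Longrightarrow> y \<in> E"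
  shows "closedin Y (f ` E)"
proof -
  have E: "E \<subseteq> topspace X" using assms(3) closedin_subset by blast
  have "topspace Y - f ` E = f ` (topspace X - E)"
  proof
    show "topspace Y - f ` E \<subseteq> f ` (topspace X - E)"
      unfolding assms(2)[symmetric] by blast
    show "f ` (topspace X - E) \<subseteq> topspace Y - f ` E"
      unfolding assms(2)[symmetric] using sat by fastforce
  qed
  moreover have "openin Y (f ` (topspace X - E))"
    using assms(1,3) by (simp add: open_map_def openin_diff)
  ultimately show ?thesis
    unfolding closedin_def using image_mono[OF E, of f] assms(2) by simp
qed

section \<open>Flows of a topological group: translations, products and quotients\<close>

locale topgroup = group G for G (structure) +
  fixes T
  assumes topological_group: "topological_group G T"
begin

lemma topspace_T [simp]: "topspace T = carrier G"
  using topological_group by (simp add: topological_group_def)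

lemma flow_act_closed:
  assumes "flow G T X act" "t \<in> carrier G" "x \<in> topspace X"
  shows "act t x \<in> topspace X"
proof -
  have "continuous_map (prod_topology T X) X (\<lambda>(t, x). act t x)"
    using assms(1) by (simp add: flow_def)
  from continuous_map_funspace[OF this] have "(\<lambda>(t, x). act t x) (t, x) \<in> topspace X"
    by (rule Pi_mem) (use assms in simp)
  then show ?thesis by simp
qed

lemma flow_mult:
  "\<lbrakk>flow G T X act; s \<in> carrier G; t \<in> carrier G; x \<in> topspace X\<rbrakk>
    \<Longrightarrow> act (s \<otimes> t) x = act s (act t x)"
  unfolding flow_def by blast

lemma flow_one: "\<lbrakk>flow G T X act; x \<in> topspace X\<rbrakk> \<Longrightarrow> act \<one> x = x"
  unfolding flow_def by blast

lemma flow_inv: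
  assumes "flow G T X act" "t \<in> carrier G" "x \<in> topspace X"
  shows "act (inv t) (act t x) = x" "act t (act (inv t) x) = x"
  using assms flow_mult[OF assms(1) _ _ assms(3), of "inv t" t]
    flow_mult[OF assms(1) _ _ assms(3), of t "inv t"] flow_one[OF assms(1,3)]
  by simp_all

lemma flow_continuous_point:
  assumes "flow G T X act" "x \<in> topspace X"
  shows "continuous_map T X (\<lambda>t. act t x)"
proof -
  have "continuous_map T (prod_topology T X) (\<lambda>t. (t, x))"
    using assms by (simp add: continuous_map_pairwise comp_def)
  then have "continuous_map T X ((\<lambda>(t, x). act t x) \<circ> (\<lambda>t. (t, x)))"
    using assms(1) unfolding flow_def by (blast intro: continuous_map_compose)
  then show ?thesis by (simp add: comp_def)
qed

lemma flow_continuous_translate: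
  assumes "flow G T X act" "t \<in> carrier G"
  shows "continuous_map X X (act t)"
proof -
  have "continuous_map X (prod_topology T X) (\<lambda>x. (t, x))"
    using assms by (simp add: continuous_map_pairwise comp_def)
  then have "continuous_map X X ((\<lambda>(t, x). act t x) \<circ> (\<lambda>x. (t, x)))"
    using assms(1) unfolding flow_def by (blast intro: continuous_map_compose)
  then show ?thesis by (simp add: comp_def)
qed

lemma flow_homeomorphic_map:
  assumes "flow G T X act" "t \<in> carrier G"
  shows "homeomorphic_map X X (act t)"
proof -
  have "homeomorphic_maps X X (act t) (act (inv t))"
    unfolding homeomorphic_maps_def
    using assms flow_continuous_translate flow_inv by auto
  then show ?thesis using homeomorphic_maps_map by blast
qed

text \<open>That \<open>x\<close> lies in the translate of a set by \<open>t\<close> means that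
  \<open>act (inv t) x\<close> lies in the set. Joint continuity turns this condition on pairs into
  a closed one when the set is closed.\<close>

lemma flow_continuous_inv:
  assumes "flow G T X act"
  shows "continuous_map (prod_topology T X) X (\<lambda>(t, x). act (inv t) x)"
proof -
  have "continuous_map T T (\<lambda>t. inv t)"
    using topological_group by (simp add: topological_group_def)
  then have "continuous_map (prod_topology T X) (prod_topology T X) (\<lambda>(t, x). (inv t, x))"
    by (simp add: continuous_map_prod_top)
  then have "continuous_map (prod_topology T X) X ((\<lambda>(t, x). act t x) \<circ> (\<lambda>(t, x). (inv t, x)))"
    using assms unfolding flow_def by (blast intro: continuous_map_compose)
  then show ?thesis by (simp add: comp_def case_prod_unfold)
qed

lemma flow_prod:
  assumes X: "flow G T X a" and Y: "flow G T Y b"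
  shows "flow G T (prod_topology X Y) (\<lambda>t (x, y). (a t x, b t y))"
proof -
  let ?P = "prod_topology T (prod_topology X Y)"
  have f: "continuous_map ?P T fst" "continuous_map ?P X (fst \<circ> snd)"
    "continuous_map ?P Y (snd \<circ> snd)"
    using continuous_map_fst continuous_map_compose[OF continuous_map_snd continuous_map_fst]
      continuous_map_compose[OF continuous_map_snd continuous_map_snd] by blast+
  have "continuous_map ?P (prod_topology T X) (\<lambda>p. (fst p, fst (snd p)))"
    "continuous_map ?P (prod_topology T Y) (\<lambda>p. (fst p, snd (snd p)))"
    using f by (auto simp: continuous_map_pairwise comp_def)
  then have "continuous_map ?P X ((\<lambda>(t, x). a t x) \<circ> (\<lambda>p. (fst p, fst (snd p))))"
    "continuous_map ?P Y ((\<lambda>(t, x). b t x) \<circ> (\<lambda>p. (fst p, snd (snd p))))"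
    using X Y unfolding flow_def by (blast intro: continuous_map_compose)+
  then have "continuous_map ?P (prod_topology X Y) (\<lambda>(t, p). case p of (x, y) \<Rightarrow> (a t x, b t y))"
    by (auto simp: continuous_map_pairwise comp_def case_prod_unfold)
  then show ?thesis
    using X Y unfolding flow_def by auto
qed

text \<open>A product of quotient maps need not be a quotient map. As \<open>q\<close> is open, so
  is its product with the identity of the group, which is therefore a quotient map, and joint
  continuity of \<open>act'\<close> can be tested upstairs, where it is that of \<open>q\<close>
  after \<open>act\<close>.\<close>

lemma flow_quotient:
  assumes X: "flow G T X act" and q: "quotient_map X Z q" "open_map X Z q"
    and eq: "\<And>t x. \<lbrakk>t \<in> carrier G; x \<in> topspace X\<rbrakk> \<Longrightarrow> q (act t x) = act' t (q x)"
  shows "flow G T Z act'"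
proof -
  have Z: "topspace Z = q ` topspace X" using q(1) by (simp add: quotient_imp_surjective_map)
  have c: "continuous_map X Z q" using q(1) by (rule quotient_imp_continuous_map)
  let ?q = "\<lambda>(t, x). (t, q x)"
  have "quotient_map (prod_topology T X) (prod_topology T Z) ?q"
  proof (rule continuous_open_imp_quotient_map)
    show "continuous_map (prod_topology T X) (prod_topology T Z) ?q"
      using c by (simp add: continuous_map_prod_top)
    show "open_map (prod_topology T X) (prod_topology T Z) ?q"
      using open_map_map_prod[of T T "\<lambda>t. t" X Z q] q(2) by (simp add: open_map_def)
    show "?q ` topspace (prod_topology T X) = topspace (prod_topology T Z)"
      by (auto simp: Z)
  qed
  moreover have "continuous_map (prod_topology T X) Z ((\<lambda>(t, x). act' t x) \<circ> ?q)"
  proof (rule continuous_map_eq)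
    show "continuous_map (prod_topology T X) Z (q \<circ> (\<lambda>(t, x). act t x))"
      using X c unfolding flow_def by (blast intro: continuous_map_compose)
  qed (auto simp: eq)
  ultimately have "continuous_map (prod_topology T Z) Z (\<lambda>(t, x). act' t x)"
    by (rule continuous_compose_quotient_map)
  moreover have "act' \<one> (q x) = q x" if "x \<in> topspace X" for x
    using eq[OF one_closed that] flow_one[OF X that] by simp
  moreover have "act' (s \<otimes> t) (q x) = act' s (act' t (q x))"
    if "s \<in> carrier G" "t \<in> carrier G" "x \<in> topspace X" for s t x
  proof -
    have "act' (s \<otimes> t) (q x) = q (act s (act t x))"
      using that eq[of "s \<otimes> t" x] flow_mult[OF X] by simp
    also have "\<dots> = act' s (act' t (q x))"
      using that eq flow_act_closed[OF X] by simp
    finally show ?thesis .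
  qed
  ultimately show ?thesis unfolding flow_def Z by blast
qed

section \<open>Translations in the group and the uniformity generated by orbits\<close>

lemma flow_left_mult: "flow G T T (\<lambda>s t. s \<otimes> t)"
  using topological_group unfolding flow_def topological_group_def by (auto simp: m_assoc)

text \<open>Right multiplication by \<open>inv s\<close> is the orbit map of the point
  \<open>inv s\<close> in the left multiplication flow, and the right translate of \<open>U\<close>
  by \<open>s\<close> is its preimage of \<open>U\<close>.\<close>

lemma openin_right_translate:
  assumes "openin T U" "s \<in> carrier G"
  shows "openin T ((\<lambda>t. t \<otimes> s) ` U)"
proof -
  have U: "U \<subseteq> carrier G" using assms(1) openin_subset by fastforce
  have "continuous_map T T (\<lambda>t. t \<otimes> inv s)"
    using flow_continuous_point[OF flow_left_mult, of "inv s"] assms by simp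
  then have "openin T {t \<in> topspace T. t \<otimes> inv s \<in> U}"
    using assms(1) by (rule openin_continuous_map_preimage)
  moreover have "{t \<in> topspace T. t \<otimes> inv s \<in> U} = (\<lambda>t. t \<otimes> s) ` U"
  proof (intro equalityI subsetI)
    fix t assume "t \<in> {t \<in> topspace T. t \<otimes> inv s \<in> U}"
    then show "t \<in> (\<lambda>t. t \<otimes> s) ` U"
      using assms(2) by (intro image_eqI[of _ _ "t \<otimes> inv s"]) (auto simp: m_assoc)
  qed (use U assms(2) in \<open>auto simp: m_assoc\<close>)
  ultimately show ?thesis by simp
qed

lemma openin_left_translate:
  assumes "openin T U" "s \<in> carrier G"
  shows "openin T ((\<lambda>t. s \<otimes> t) ` U)"
  using flow_homeomorphic_map[OF flow_left_mult assms(2)] assms(1)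
  by (meson homeomorphic_imp_open_map open_map_def)

text \<open>The sets \<open>{(z, tz) | t \<in> V}\<close> with \<open>V\<close> a neighbourhood of the identity generate a
  uniformity; openness of the orbit maps makes it induce the given topology.\<close>

lemma uniformity_of_orbits:
  assumes Z: "flow G T Z act"
    and orbit: "\<And>V z. \<lbrakk>openin T V; \<one> \<in> V; z \<in> topspace Z\<rbrakk> \<Longrightarrow> openin Z ((\<lambda>t. act t z) ` V)"
  shows "uniformity_of Z {\<alpha>. \<alpha> \<subseteq> topspace Z \<times> topspace Z \<and>
    (\<exists>V. openin T V \<and> \<one> \<in> V \<and> (\<forall>z\<in>topspace Z. \<forall>t\<in>V. (z, act t z) \<in> \<alpha>))}"
    (is "uniformity_of Z ?U")
proof -
  \<comment> \<open>\<open>?E V\<close> is the basic entourage of \<open>V\<close>; the members of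
    \<open>?U\<close> are the relations on the space containing one of these.\<close>
  let ?E = "\<lambda>V. {(z, act t z) |z t. z \<in> topspace Z \<and> t \<in> V}"
  have V_sub: "V \<subseteq> carrier G" if "openin T V" for V
    using openin_subset[OF that] by simp
  have E: "?E V \<in> ?U" if "openin T V" "\<one> \<in> V" for V
    using that V_sub[OF that(1)] flow_act_closed[OF Z] by blast
  have UI: "\<alpha> \<in> ?U" if "openin T V" "\<one> \<in> V" "\<alpha> \<subseteq> topspace Z \<times> topspace Z"
    "\<And>z t. \<lbrakk>z \<in> topspace Z; t \<in> V\<rbrakk> \<Longrightarrow> (z, act t z) \<in> \<alpha>" for \<alpha> V
    using that by blast
  have UE: "\<exists>V. openin T V \<and> \<one> \<in> V \<and> (\<forall>z\<in>topspace Z. \<forall>t\<in>V. (z, act t z) \<in> \<alpha>)"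
    "\<alpha> \<subseteq> topspace Z \<times> topspace Z" if "\<alpha> \<in> ?U" for \<alpha>
    using that by blast+
  have "is_uniformity (topspace Z) ?U"
    unfolding is_uniformity_def
  proof (intro conjI ballI allI impI)
    have "openin T (topspace T)" by blast
    then show "?U \<noteq> {}" using E[of "topspace T"] by auto
  next
    fix \<alpha> assume "\<alpha> \<in> ?U"
    note \<alpha> = UE[OF this]
    then obtain V where V: "openin T V" "\<one> \<in> V" "\<forall>z\<in>topspace Z. \<forall>t\<in>V. (z, act t z) \<in> \<alpha>"
      by blast
    show "\<alpha> \<subseteq> topspace Z \<times> topspace Z" by (rule \<alpha>(2))
    show "Id_on (topspace Z) \<subseteq> \<alpha>"
    proof
      fix p assume "p \<in> Id_on (topspace Z)"
      then obtain z where "z \<in> topspace Z" "p = (z, z)" by blast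
      then show "p \<in> \<alpha>" using V(2,3) flow_one[OF Z, of z] by force
    qed
    show "\<beta> \<in> ?U" if "\<alpha> \<subseteq> \<beta> \<and> \<beta> \<subseteq> topspace Z \<times> topspace Z" for \<beta>
      using that V by (intro UI[of V]) auto
    show "\<alpha> \<inter> \<beta> \<in> ?U" if \<beta>: "\<beta> \<in> ?U" for \<beta>
    proof -
      obtain W where W: "openin T W" "\<one> \<in> W" "\<forall>z\<in>topspace Z. \<forall>t\<in>W. (z, act t z) \<in> \<beta>"
        using UE(1)[OF \<beta>] by blast
      show ?thesis
        using V W \<alpha>(2) by (intro UI[of "V \<inter> W"]) (auto intro: openin_Int)
    qed
    show "\<alpha>\<inverse> \<in> ?U"
    proof (rule UI)
      have "continuous_map T T (\<lambda>t. inv t)"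
        using topological_group by (simp add: topological_group_def)
      then show "openin T {t \<in> topspace T. inv t \<in> V}"
        using V(1) by (rule openin_continuous_map_preimage)
      show "\<one> \<in> {t \<in> topspace T. inv t \<in> V}" using V(2) by simp
      show "\<alpha>\<inverse> \<subseteq> topspace Z \<times> topspace Z" using \<alpha>(2) by blast
      show "(z, act t z) \<in> \<alpha>\<inverse>" if "z \<in> topspace Z" "t \<in> {t \<in> topspace T. inv t \<in> V}" for z t
      proof -
        \<comment> \<open>The base point is \<open>act t z\<close>: moving it by
          \<open>inv t\<close>, an element of \<open>V\<close>, leads back to
          \<open>z\<close>.\<close>
        have "(act t z, act (inv t) (act t z)) \<in> \<alpha>"
          using that V(3) flow_act_closed[OF Z] by simp
        then show ?thesis using that flow_inv[OF Z, of t z] by simp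
      qed
    qed
    show "\<exists>\<beta>\<in>?U. \<beta> O \<beta> \<subseteq> \<alpha>"
    proof -
      have "continuous_map (prod_topology T T) T (\<lambda>(s, t). s \<otimes> t)"
        using topological_group by (simp add: topological_group_def)
      then have "openin (prod_topology T T)
          {p \<in> topspace (prod_topology T T). (case p of (s, t) \<Rightarrow> s \<otimes> t) \<in> V}"
        using V(1) by (rule openin_continuous_map_preimage)
      moreover have "(\<one>, \<one>) \<in> {p \<in> topspace (prod_topology T T). (case p of (s, t) \<Rightarrow> s \<otimes> t) \<in> V}"
        using V(2) by simp
      ultimately obtain W1 W2 where W: "openin T W1" "openin T W2" "\<one> \<in> W1" "\<one> \<in> W2"
        "W1 \<times> W2 \<subseteq> {p \<in> topspace (prod_topology T T). (case p of (s, t) \<Rightarrow> s \<otimes> t) \<in> V}"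
        unfolding openin_prod_topology_alt by meson
      \<comment> \<open>Moving first by \<open>s\<close> and then by \<open>t\<close> amounts to
        moving by \<open>t \<otimes> s\<close>, which lies in \<open>V\<close>.\<close>
      have "?E (W1 \<inter> W2) \<in> ?U" using W by (intro E) auto
      moreover have "?E (W1 \<inter> W2) O ?E (W1 \<inter> W2) \<subseteq> \<alpha>"
      proof clarsimp
        fix z s t
        assume z: "z \<in> topspace Z" and s: "s \<in> W1" "s \<in> W2" and t: "t \<in> W1" "t \<in> W2"
        have "s \<in> carrier G" "t \<in> carrier G" "t \<otimes> s \<in> V"
          using W(5) s t by auto
        then show "(z, act t (act s z)) \<in> \<alpha>"
          using V(3) z flow_mult[OF Z, of t s z] by metis
      qed
      ultimately show ?thesis by blast
    qed
  qed
  moreover have "openin Z U \<longleftrightarrow> U \<subseteq> topspace Z \<and> (\<forall>z\<in>U. \<exists>\<alpha>\<in>?U. \<alpha> `` {z} \<subseteq> U)" for U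
  proof (intro iffI conjI ballI)
    assume U: "openin Z U"
    then show U_sub: "U \<subseteq> topspace Z" by (rule openin_subset)
    fix z assume z: "z \<in> U"
    \<comment> \<open>The elements that move \<open>z\<close> into \<open>U\<close>; this set is
      open by continuity of the orbit map.\<close>
    let ?V = "{t \<in> topspace T. act t z \<in> U}"
    have "openin T ?V"
      by (rule openin_continuous_map_preimage[OF flow_continuous_point[OF Z] U]) (use U_sub z in blast)
    moreover have "\<one> \<in> ?V" using flow_one[OF Z, of z] U_sub z by auto
    ultimately have "?E ?V \<in> ?U" by (rule E)
    moreover have "?E ?V `` {z} \<subseteq> U" by auto
    ultimately show "\<exists>\<alpha>\<in>?U. \<alpha> `` {z} \<subseteq> U" by blast
  next
    assume U: "U \<subseteq> topspace Z \<and> (\<forall>z\<in>U. \<exists>\<alpha>\<in>?U. \<alpha> `` {z} \<subseteq> U)"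
    show "openin Z U"
    proof (subst openin_subopen, intro ballI)
      fix z assume z: "z \<in> U"
      with U have zZ: "z \<in> topspace Z" by blast
      from U z obtain \<alpha> where \<alpha>: "\<alpha> \<in> ?U" "\<alpha> `` {z} \<subseteq> U" by meson
      then obtain V where V: "openin T V" "\<one> \<in> V" "\<forall>z\<in>topspace Z. \<forall>t\<in>V. (z, act t z) \<in> \<alpha>"
        using UE(1)[OF \<alpha>(1)] by blast
      \<comment> \<open>Openness of the orbit map enters here: the points \<open>act t z\<close>
        with \<open>t\<close> in \<open>V\<close> form an open neighbourhood of \<open>z\<close>
        inside \<open>U\<close>.\<close>
      have "openin Z ((\<lambda>t. act t z) ` V)" using V zZ by (intro orbit)
      moreover have "z \<in> (\<lambda>t. act t z) ` V" using V(2) flow_one[OF Z zZ] by force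
      moreover have "(\<lambda>t. act t z) ` V \<subseteq> U" using V(3) zZ \<alpha>(2) by blast
      ultimately show "\<exists>W. openin Z W \<and> z \<in> W \<and> W \<subseteq> U" by blast
    qed
  qed
  ultimately show ?thesis unfolding uniformity_of_def by blast
qed

end

section \<open>The coset space T/H and closedness of unions of translates\<close>

locale cocompact_subgroup = topgroup G T + normal H G for G (structure) and T and H +
  assumes closed_H: "closedin T H" and compact_coset_space: "compact_space (left_coset_space G T H)"
begin

lemma topspace_left_coset_space: "topspace (left_coset_space G T H) = (\<lambda>s. s <# H) ` carrier G"
  by (simp add: left_coset_space_def topspace_quotient_topology)

lemma coset_map_quotient: "quotient_map T (left_coset_space G T H) (\<lambda>s. s <# H)"
  unfolding left_coset_space_def by (rule quotient_map_quotient_topology)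

lemma coset_eq_iff:
  assumes "s \<in> carrier G" "t \<in> carrier G"
  shows "s <# H = t <# H \<longleftrightarrow> (\<exists>h\<in>H. s = t \<otimes> h)"
proof
  assume "s <# H = t <# H"
  moreover have "s \<in> s <# H" unfolding l_coset_def using assms one_closed by force
  ultimately show "\<exists>h\<in>H. s = t \<otimes> h" unfolding l_coset_def by auto
next
  assume "\<exists>h\<in>H. s = t \<otimes> h"
  then obtain h where h: "h \<in> H" "s = t \<otimes> h" by blast
  then have "s <# H = t <# (h <# H)" using assms by (simp add: lcos_m_assoc subset)
  also have "h <# H = H" using h by (simp add: coset_join3 subset subgroup_axioms)
  finally show "s <# H = t <# H" .
qed

text \<open>The saturation of an open set \<open>U\<close> is UH, a union of right translates of
  \<open>U\<close>.\<close>

lemma coset_map_open: "open_map T (left_coset_space G T H) (\<lambda>s. s <# H)"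
  unfolding open_map_def
proof (intro allI impI)
  fix U assume U: "openin T U"
  then have U_sub: "U \<subseteq> carrier G" using openin_subset by fastforce
  have "{s \<in> topspace T. s <# H \<in> (\<lambda>s. s <# H) ` U} = (\<Union>h\<in>H. (\<lambda>t. t \<otimes> h) ` U)"
  proof (intro equalityI subsetI)
    fix s assume "s \<in> {s \<in> topspace T. s <# H \<in> (\<lambda>s. s <# H) ` U}"
    then obtain u where "u \<in> U" "s \<in> carrier G" "s <# H = u <# H" by auto
    then show "s \<in> (\<Union>h\<in>H. (\<lambda>t. t \<otimes> h) ` U)" using coset_eq_iff[of s u] U_sub by auto
  next
    fix s assume "s \<in> (\<Union>h\<in>H. (\<lambda>t. t \<otimes> h) ` U)"
    then obtain h u where hu: "h \<in> H" "u \<in> U" "s = u \<otimes> h" by blast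
    then have "s \<in> carrier G" using U_sub by auto
    with hu show "s \<in> {s \<in> topspace T. s <# H \<in> (\<lambda>s. s <# H) ` U}"
      using coset_eq_iff[of s u] U_sub by auto
  qed
  moreover have "openin T (\<Union>h\<in>H. (\<lambda>t. t \<otimes> h) ` U)"
    using U by (intro openin_Union) (auto intro: openin_right_translate)
  ultimately show "openin (left_coset_space G T H) ((\<lambda>s. s <# H) ` U)"
    using U_sub by (auto simp: left_coset_space_def openin_quotient_topology)
qed

text \<open>Openness of the coset map lets the left multiplication flow descend to the
  cosets.\<close>

lemma flow_left_coset_space: "flow G T (left_coset_space G T H) (\<lambda>t C. t <# C)"
  using flow_left_mult coset_map_quotient coset_map_open
  by (rule flow_quotient) (simp add: lcos_m_assoc subset)

lemma flow_coset_product: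
  assumes "flow G T X act"
  shows "flow G T (prod_topology X (left_coset_space G T H)) (coset_product_action G act)"
proof -
  have "coset_product_action G act = (\<lambda>t (x, C). (act t x, t <# C))"
    by (rule ext) (simp add: coset_product_action_def)
  then show ?thesis using flow_prod[OF assms flow_left_coset_space] by simp
qed

text \<open>\<open>H\<close> is closed in the group and is a full fibre of the coset map, so its
  one-point image is closed.\<close>

lemma closedin_singleton_coset: "closedin (left_coset_space G T H) {H}"
proof -
  have "closedin (left_coset_space G T H) ((\<lambda>s. s <# H) ` H)"
  proof (rule open_map_image_closedin[OF coset_map_open _ closed_H])
    show "(\<lambda>s. s <# H) ` topspace T = topspace (left_coset_space G T H)"
      by (simp add: topspace_left_coset_space)
    fix x y assume "x \<in> H" "y \<in> topspace T" "y <# H = x <# H"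
    then show "y \<in> H" using coset_eq_iff[of y x] by auto
  qed
  moreover have "(\<lambda>s. s <# H) ` H = {H}"
  proof -
    have "s <# H = H" if "s \<in> H" for s
      using that by (simp add: coset_join3 subset subgroup_axioms)
    then show ?thesis
      by (simp add: image_constant[OF subgroup.one_closed[OF subgroup_axioms]] cong: image_cong_simp)
  qed
  ultimately show ?thesis by simp
qed

text \<open>In \<open>T/H \<times> X\<close> the set of all \<open>(tH, x)\<close> with \<open>t \<in> D\<close> and \<open>x \<in> tM\<close> is closed, and projecting
  along the compact factor \<open>T/H\<close> preserves closedness.\<close>

lemma closedin_translates:
  assumes X: "flow G T X act" and M: "closedin X M" and D: "closedin T D"
    and HM: "\<And>h x. \<lbrakk>h \<in> H; x \<in> M\<rbrakk> \<Longrightarrow> act h x \<in> M"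
    and DH: "\<And>t h. \<lbrakk>t \<in> D; h \<in> H\<rbrakk> \<Longrightarrow> t \<otimes> h \<in> D"
  shows "closedin X {act t x |t x. t \<in> D \<and> x \<in> M}"
proof -
  let ?P = "prod_topology T X" and ?Q = "prod_topology (left_coset_space G T H) X"
  let ?q = "\<lambda>(t, x). (t <# H, x)"
  let ?E = "{p \<in> topspace ?P. fst p \<in> D} \<inter> {p \<in> topspace ?P. (case p of (t, x) \<Rightarrow> act (inv t) x) \<in> M}"
  have M_sub: "M \<subseteq> topspace X" and D_sub: "D \<subseteq> carrier G"
    using M D closedin_subset by fastforce+
  have "closedin ?P ?E"
    using D M flow_continuous_inv[OF X] continuous_map_fst[of T X]
    by (intro closedin_Int) (blast intro: closedin_continuous_map_preimage)+
  have "closedin ?Q (?q ` ?E)"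
  proof (rule open_map_image_closedin[OF _ _ \<open>closedin ?P ?E\<close>])
    show "open_map ?P ?Q ?q"
      using open_map_map_prod[OF coset_map_open, of X X "\<lambda>x. x"] by (simp add: open_map_def)
    show "?q ` topspace ?P = topspace ?Q"
      by (auto simp: topspace_left_coset_space)
    \<comment> \<open>Saturation: another representative of the coset of \<open>t\<close> has the
      form \<open>t \<otimes> h\<close>. It stays in \<open>D\<close> by \<open>DH\<close>, and it
      changes \<open>act (inv t) x\<close> only by \<open>inv h\<close>, which keeps it in
      \<open>M\<close> by \<open>HM\<close>.\<close>
    fix p p' assume p: "p \<in> ?E" and p': "p' \<in> topspace ?P" and eq: "?q p' = ?q p"
    obtain t x where tx: "p = (t, x)" by fastforce
    with eq obtain s where s: "p' = (s, x)" "s <# H = t <# H" by (cases p') auto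
    have t: "t \<in> carrier G" "t \<in> D" "x \<in> topspace X" "act (inv t) x \<in> M"
      using p tx by auto
    have sG: "s \<in> carrier G" using p' s by auto
    obtain h where h: "h \<in> H" "s = t \<otimes> h" using coset_eq_iff[OF sG t(1)] s(2) by blast
    then have "act (inv s) x = act (inv h) (act (inv t) x)"
      using t flow_mult[OF X, of "inv h" "inv t" x] by (simp add: inv_mult_group)
    also have "\<dots> \<in> M" using HM h t by simp
    finally show "p' \<in> ?E" using p' s DH[OF t(2) h(1)] h by simp
  qed
  then have "closedin X (snd ` ?q ` ?E)"
    using closed_map_snd[OF compact_coset_space, of X] by (simp add: closed_map_def)
  moreover have "snd ` ?q ` ?E = {act t x |t x. t \<in> D \<and> x \<in> M}"
  proof (intro equalityI subsetI)
    fix y assume "y \<in> snd ` ?q ` ?E"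
    then obtain t where t: "t \<in> D" "act (inv t) y \<in> M" "y \<in> topspace X" by auto
    then have "y = act t (act (inv t) y)" using flow_inv[OF X, of t y] D_sub by auto
    then show "y \<in> {act t x |t x. t \<in> D \<and> x \<in> M}" using t by blast
  next
    fix y assume "y \<in> {act t x |t x. t \<in> D \<and> x \<in> M}"
    then obtain t x where tx: "t \<in> D" "x \<in> M" "y = act t x" by blast
    then have "(t, y) \<in> ?E"
      using flow_inv(1)[OF X, of t x] flow_act_closed[OF X, of t x] D_sub M_sub by (simp add: subset_eq)
    then show "y \<in> snd ` ?q ` ?E" by force
  qed
  ultimately show ?thesis by simp
qed

section \<open>Almost periodicity of transitive flows on which H acts trivially\<close>

text \<open>The elements taking \<open>z\<close> into Vz form VS, with S the stabiliser of
  \<open>z\<close>, which is open. The complement D is closed and satisfies DH = D because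
  \<open>H\<close> fixes \<open>z\<close>, so \<open>closedin_translates\<close> with the closed set
  \<open>{z}\<close> makes Dz closed. By transitivity Dz is the complement of Vz.\<close>

lemma transitive_flow_orbit_map_open:
  assumes Z: "flow G T Z act" "Hausdorff_space Z"
    and z: "z \<in> topspace Z" "\<And>h. h \<in> H \<Longrightarrow> act h z = z"
    and trans: "topspace Z \<subseteq> (\<lambda>t. act t z) ` carrier G"
    and V: "openin T V"
  shows "openin Z ((\<lambda>t. act t z) ` V)"
proof -
  let ?VS = "{t \<in> carrier G. act t z \<in> (\<lambda>t. act t z) ` V}"
  let ?S = "{s \<in> carrier G. act s z = z}"
  have V_sub: "V \<subseteq> carrier G" using V openin_subset by fastforce
  \<comment> \<open>\<open>act t z = act v z\<close> holds exactly when
    \<open>inv v \<otimes> t\<close> fixes \<open>z\<close>.\<close>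
  have "?VS = (\<Union>s\<in>?S. (\<lambda>t. t \<otimes> s) ` V)"
  proof (intro equalityI subsetI)
    fix t assume "t \<in> ?VS"
    then obtain v where v: "t \<in> carrier G" "v \<in> V" "act t z = act v z" by blast
    have "act (inv v \<otimes> t) z = act (inv v) (act v z)"
      using v V_sub z(1) flow_mult[OF Z(1), of "inv v" t z] by auto
    then have "act (inv v \<otimes> t) z = z"
      using v V_sub z(1) flow_inv[OF Z(1), of v z] by auto
    moreover have "t = v \<otimes> (inv v \<otimes> t)"
      using v V_sub by (simp add: m_assoc[symmetric] subsetD)
    ultimately show "t \<in> (\<Union>s\<in>?S. (\<lambda>t. t \<otimes> s) ` V)"
      using v V_sub by (intro UN_I[of "inv v \<otimes> t"]) auto
  next
    fix t assume "t \<in> (\<Union>s\<in>?S. (\<lambda>t. t \<otimes> s) ` V)"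
    then obtain s v where "s \<in> ?S" "v \<in> V" "t = v \<otimes> s" by blast
    then show "t \<in> ?VS" using V_sub z(1) flow_mult[OF Z(1), of v s z] by auto
  qed
  moreover have "openin T (\<Union>s\<in>?S. (\<lambda>t. t \<otimes> s) ` V)"
    using V by (intro openin_Union) (auto intro: openin_right_translate)
  ultimately have D: "closedin T (carrier G - ?VS)"
    using openin_closedin_eq closedin_topspace closedin_diff topspace_T by metis
  have "closedin Z {act t x |t x. t \<in> carrier G - ?VS \<and> x \<in> {z}}"
  proof (rule closedin_translates[OF Z(1) _ D])
    show "closedin Z {z}" using Z(2) z(1) by (simp add: closedin_Hausdorff_singleton)
    show "t \<otimes> h \<in> carrier G - ?VS" if "t \<in> carrier G - ?VS" "h \<in> H" for t h
      using that z(2)[of h] flow_mult[OF Z(1) _ _ z(1), of t h] by auto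
    show "act h x \<in> {z}" if "h \<in> H" "x \<in> {z}" for h x
      using that z(2) by simp
  qed
  moreover have "{act t x |t x. t \<in> carrier G - ?VS \<and> x \<in> {z}} = topspace Z - (\<lambda>t. act t z) ` V"
  proof (intro equalityI subsetI)
    fix y assume "y \<in> {act t x |t x. t \<in> carrier G - ?VS \<and> x \<in> {z}}"
    then show "y \<in> topspace Z - (\<lambda>t. act t z) ` V"
      using flow_act_closed[OF Z(1) _ z(1)] by auto
  next
    fix y assume "y \<in> topspace Z - (\<lambda>t. act t z) ` V"
    then show "y \<in> {act t x |t x. t \<in> carrier G - ?VS \<and> x \<in> {z}}"
      using trans by auto
  qed
  moreover have "(\<lambda>t. act t z) ` V \<subseteq> topspace Z"
    using V_sub flow_act_closed[OF Z(1) _ z(1)] by auto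
  ultimately show ?thesis by (simp add: openin_closedin)
qed

text \<open>The images of the sets sV form an open cover of the compact space T/H. A finite
  subcover, indexed by \<open>F\<close>, shows that the whole group is FVH.\<close>

lemma syndetic_neighbourhood:
  assumes "openin T V" "\<one> \<in> V"
  shows "syndetic G T (V <#> H)"
proof -
  let ?Q = "left_coset_space G T H"
  define C where "C s = (\<lambda>s. s <# H) ` (\<lambda>t. s \<otimes> t) ` V" for s
  have V_sub: "V \<subseteq> carrier G" using openin_subset[OF assms(1)] by simp
  have mult: "s \<otimes> t \<in> carrier G" if "s \<in> carrier G" "t \<in> carrier G" for s t
    using that by (rule monoid.m_closed[OF monoid_axioms])
  have open_C: "openin ?Q (C s)" if "s \<in> carrier G" for s
    using coset_map_open openin_left_translate[OF assms(1) that] by (simp add: open_map_def C_def)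
  have mem_C: "s <# H \<in> C s" if "s \<in> carrier G" for s
  proof -
    have "s \<otimes> \<one> \<in> (\<lambda>t. s \<otimes> t) ` V" using assms(2) by (rule imageI)
    then show ?thesis using that unfolding C_def by simp
  qed
  have "topspace ?Q \<subseteq> \<Union>(C ` carrier G)"
    using mem_C by (auto simp: topspace_left_coset_space)
  then obtain \<F> where \<F>: "finite \<F>" "\<F> \<subseteq> C ` carrier G" "topspace ?Q \<subseteq> \<Union>\<F>"
    using compactinD[OF compact_coset_space[unfolded compact_space_def], of "C ` carrier G"] open_C
    by blast
  obtain F where F: "F \<subseteq> carrier G" "finite F" "\<F> = C ` F"
    using finite_subset_image[OF \<F>(1,2)] by (elim exE conjE) (rule that)
  \<comment> \<open>\<open>syndetic\<close> inverts its compact set, so the inverses of the elements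
    of \<open>F\<close> are taken in order to get \<open>F\<close> back.\<close>
  let ?K = "(\<lambda>s. inv s) ` F"
  have K: "set_inv ?K = F"
  proof -
    have "set_inv ?K = (\<lambda>s. inv (inv s)) ` F" unfolding SET_INV_def by auto
    also have "\<dots> = (\<lambda>s. s) ` F" using F(1) by (intro image_cong) auto
    finally show ?thesis by simp
  qed
  have cover: "\<exists>s\<in>F. t <# H \<in> C s" if "t \<in> carrier G" for t
    using \<F>(3) that unfolding F(3) topspace_left_coset_space by blast
  then have "F \<noteq> {}" using monoid.one_closed[OF monoid_axioms] by blast
  then have "?K \<noteq> {}" by simp
  moreover have "compactin T ?K"
  proof (rule finite_imp_compactin)
    show "?K \<subseteq> topspace T" using F(1) by auto
  qed (use F(2) in simp)
  moreover have "carrier G = F <#> (V <#> H)"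
  proof (rule equalityI; rule subsetI)
    fix t assume t: "t \<in> carrier G"
    then obtain s where s: "s \<in> F" "t <# H \<in> C s" using cover by blast
    then obtain v where v: "v \<in> V" "t <# H = s \<otimes> v <# H" unfolding C_def by blast
    have G: "s \<in> carrier G" "v \<in> carrier G" using s(1) v(1) F(1) V_sub by blast+
    obtain h where h: "h \<in> H" "t = s \<otimes> v \<otimes> h"
      using coset_eq_iff[OF t mult[OF G]] v(2) by blast
    have "t = s \<otimes> (v \<otimes> h)" using G h by (simp add: m_assoc)
    then show "t \<in> F <#> (V <#> H)"
      using s(1) v(1) h(1) unfolding set_mult_def by blast
  next
    fix t assume "t \<in> F <#> (V <#> H)"
    then obtain s v h where svh: "s \<in> F" "v \<in> V" "h \<in> H" "t = s \<otimes> (v \<otimes> h)"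
      unfolding set_mult_def by blast
    then have "s \<in> carrier G" "v \<in> carrier G" "h \<in> carrier G" using F(1) V_sub subset by blast+
    then show "t \<in> carrier G" using svh(4) mult by simp
  qed
  moreover have "V <#> H \<subseteq> carrier G" using V_sub subset by (rule setmult_subset_G)
  ultimately show ?thesis unfolding syndetic_def by (metis K)
qed

text \<open>Orbit maps are open, so the orbit uniformity induces the topology. As \<open>H\<close>
  fixes every point, \<open>v \<otimes> h\<close> acts as \<open>v\<close> does; if \<open>V\<close>
  moves each point within \<alpha>, so does the syndetic set VH.\<close>

lemma transitive_flow_almost_periodic:
  assumes Z: "flow G T Z act" "Hausdorff_space Z" "compact_space Z"
    and triv: "\<And>h z. \<lbrakk>h \<in> H; z \<in> topspace Z\<rbrakk> \<Longrightarrow> act h z = z"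
    and trans: "\<And>z. z \<in> topspace Z \<Longrightarrow> topspace Z \<subseteq> (\<lambda>t. act t z) ` carrier G"
  shows "almost_periodic_flow G T Z act"
proof -
  let ?U = "{\<alpha>. \<alpha> \<subseteq> topspace Z \<times> topspace Z \<and>
    (\<exists>V. openin T V \<and> \<one> \<in> V \<and> (\<forall>z\<in>topspace Z. \<forall>t\<in>V. (z, act t z) \<in> \<alpha>))}"
  have "uniformity_of Z ?U"
  proof (rule uniformity_of_orbits[OF Z(1)])
    fix V z assume V: "openin T V" and z: "z \<in> topspace Z"
    have "act h z = z" if "h \<in> H" for h using that z by (rule triv)
    with Z(1,2) z show "openin Z ((\<lambda>t. act t z) ` V)"
      using trans[OF z] V
      by (rule transitive_flow_orbit_map_open[where Z = Z and act = act and z = z and V = V])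
  qed
  moreover have "\<exists>A. syndetic G T A \<and> (\<forall>z\<in>topspace Z. (\<lambda>t. act t z) ` A \<subseteq> \<alpha> `` {z})"
    if \<alpha>: "\<alpha> \<in> ?U" for \<alpha>
  proof -
    obtain V where V: "openin T V" "\<one> \<in> V" "\<forall>z\<in>topspace Z. \<forall>t\<in>V. (z, act t z) \<in> \<alpha>"
      using CollectD[OF \<alpha>, THEN conjunct2] by (elim exE conjE) (rule that)
    have V_sub: "V \<subseteq> carrier G" using openin_subset[OF V(1)] by simp
    have "(\<lambda>t. act t z) ` (V <#> H) \<subseteq> \<alpha> `` {z}" if z: "z \<in> topspace Z" for z
    proof (rule image_subsetI)
      fix t assume "t \<in> V <#> H"
      then obtain v h where vh: "v \<in> V" "h \<in> H" "t = v \<otimes> h" unfolding set_mult_def by blast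
      then have "act t z = act v z"
        using V_sub triv[OF vh(2) z] flow_mult[OF Z(1) _ _ z, of v h] by (simp add: subset_eq)
      then show "act t z \<in> \<alpha> `` {z}" using V(3) z vh(1) by (simp add: Image_singleton_iff)
    qed
    then show ?thesis using syndetic_neighbourhood[OF V(1,2)] by (intro exI conjI ballI)
  qed
  ultimately show ?thesis
    using Z unfolding almost_periodic_flow_def by (intro conjI exI[of _ ?U] ballI)
qed

end

section \<open>Orbit closures under H in a minimal flow\<close>

locale minimal_cocompact = cocompact_subgroup G T H for G (structure) and T H +
  fixes X act
  assumes compact_X: "compact_space X" and Hausdorff_X: "Hausdorff_space X"
    and nonempty_X: "topspace X \<noteq> {}" and minimal: "minimal_flow G T X act"
begin

abbreviation orbit_closure :: "'c \<Rightarrow> 'c set" where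
  "orbit_closure x \<equiv> X closure_of ((\<lambda>h. act h x) ` H)"

lemma flow_X: "flow G T X act"
  using minimal by (simp add: minimal_flow_def)

lemma H_orbit_subset: "x \<in> topspace X \<Longrightarrow> (\<lambda>h. act h x) ` H \<subseteq> topspace X"
  using flow_act_closed[OF flow_X] by (simp add: image_subset_iff)

lemma self_in_orbit_closure:
  assumes "x \<in> topspace X"
  shows "x \<in> orbit_closure x"
proof -
  have "x \<in> (\<lambda>h. act h x) ` H"
    using flow_one[OF flow_X assms] subgroup.one_closed[OF subgroup_axioms]
    by (metis image_eqI)
  then show ?thesis using closure_of_subset[OF H_orbit_subset[OF assms]] by blast
qed

lemma orbit_closure_minimal:
  assumes "closedin X F" "x \<in> F" "\<And>h y. \<lbrakk>h \<in> H; y \<in> F\<rbrakk> \<Longrightarrow> act h y \<in> F"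
  shows "orbit_closure x \<subseteq> F"
  using assms by (intro closure_of_minimal) (simp_all add: image_subset_iff)

text \<open>Normality gives tH = Ht, so \<open>act t\<close> maps the \<open>H\<close>-orbit of
  \<open>x\<close> onto that of \<open>act t x\<close>; as a homeomorphism it also maps closure onto
  closure.\<close>

lemma act_image_orbit_closure:
  assumes t: "t \<in> carrier G" and x: "x \<in> topspace X"
  shows "act t ` orbit_closure x = orbit_closure (act t x)"
proof -
  have "act t ` (\<lambda>h. act h x) ` H = (\<lambda>h. act h (act t x)) ` H"
  proof (intro equalityI subsetI)
    fix y assume "y \<in> act t ` (\<lambda>h. act h x) ` H"
    then obtain h where h: "h \<in> H" "y = act t (act h x)" by blast
    let ?k = "t \<otimes> h \<otimes> inv t"
    have k: "?k \<in> H" using inv_op_closed2[OF t h(1)] .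
    have "act ?k (act t x) = act (?k \<otimes> t) x"
      using flow_mult[OF flow_X _ t x, of ?k] k by simp
    also have "?k \<otimes> t = t \<otimes> h" using t h(1) by (simp add: m_assoc)
    also have "act (t \<otimes> h) x = y" using flow_mult[OF flow_X t _ x, of h] h by simp
    finally show "y \<in> (\<lambda>h. act h (act t x)) ` H" using k by (metis image_eqI)
  next
    fix y assume "y \<in> (\<lambda>h. act h (act t x)) ` H"
    then obtain h where h: "h \<in> H" "y = act h (act t x)" by blast
    let ?k = "inv t \<otimes> h \<otimes> t"
    have k: "?k \<in> H" using inv_op_closed1[OF t h(1)] .
    have "act t (act ?k x) = act (t \<otimes> ?k) x"
      using flow_mult[OF flow_X t _ x, of ?k] k by simp
    also have "t \<otimes> ?k = h \<otimes> t" using t h(1) by (simp add: m_assoc[symmetric])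
    also have "act (h \<otimes> t) x = y" using flow_mult[OF flow_X _ t x, of h] h by simp
    finally show "y \<in> act t ` (\<lambda>h. act h x) ` H" using k by (metis image_eqI)
  qed
  then show ?thesis
    using homeomorphic_map_closure_of[OF flow_homeomorphic_map[OF flow_X t] H_orbit_subset[OF x]]
    by simp
qed

text \<open>Each \<open>act h\<close> maps the \<open>H\<close>-orbit of \<open>x\<close> into
  itself, and by continuity its closure as well.\<close>

lemma orbit_closure_invariant:
  assumes "h \<in> H" "x \<in> topspace X" "y \<in> orbit_closure x"
  shows "act h y \<in> orbit_closure x"
proof -
  have "act h ` orbit_closure x \<subseteq> X closure_of (act h ` (\<lambda>h. act h x) ` H)"
    using assms(1) by (intro continuous_map_image_closure_subset flow_continuous_translate[OF flow_X]) simp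
  also have "\<dots> \<subseteq> orbit_closure x"
  proof (rule closure_of_mono, rule image_subsetI)
    fix y assume "y \<in> (\<lambda>h. act h x) ` H"
    then obtain k where k: "k \<in> H" "y = act k x" by blast
    then have "act h y = act (h \<otimes> k) x" using flow_mult[OF flow_X _ _ assms(2), of h k] assms(1) by simp
    moreover have "h \<otimes> k \<in> H" using assms(1) k(1) by (rule subgroup.m_closed[OF subgroup_axioms])
    ultimately show "act h y \<in> (\<lambda>h. act h x) ` H" by (rule image_eqI)
  qed
  finally show ?thesis using assms(3) by blast
qed

lemma orbit_closure_subset_topspace: "y \<in> orbit_closure x \<Longrightarrow> y \<in> topspace X"
  using closure_of_subset_topspace by (rule subsetD)

section \<open>Minimal sets for H and the partition into their translates\<close>

text \<open>Zorn's lemma is applied to complements: a maximal proper open set with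
  \<open>H\<close>-invariant complement leaves a minimal nonempty closed \<open>H\<close>-invariant
  set. Intersections of chains become unions, and compactness keeps these proper.\<close>

lemma exists_H_minimal:
  "\<exists>x\<in>topspace X. \<forall>y\<in>orbit_closure x. orbit_closure y = orbit_closure x"
proof -
  let ?A = "{U. openin X U \<and> U \<noteq> topspace X \<and> (\<forall>h\<in>H. \<forall>x\<in>topspace X - U. act h x \<in> topspace X - U)}"
  have "\<exists>M\<in>?A. \<forall>U\<in>?A. M \<subseteq> U \<longrightarrow> U = M"
  proof (rule subset_Zorn_nonempty)
    have "{} \<in> ?A" using nonempty_X[symmetric] flow_act_closed[OF flow_X] by simp
    then show "?A \<noteq> {}" by blast
    fix \<C> assume \<C>: "\<C> \<noteq> {}" "subset.chain ?A \<C>"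
    then have sub: "\<C> \<subseteq> ?A" by (simp add: subset_chain_def)
    have "\<Union>\<C> \<noteq> topspace X"
    proof
      assume "\<Union>\<C> = topspace X"
      moreover have "\<forall>U\<in>\<C>. openin X U" using sub by blast
      ultimately obtain \<F> where \<F>: "finite \<F>" "\<F> \<subseteq> \<C>" "topspace X \<subseteq> \<Union>\<F>"
        using compact_X[unfolded compact_space_alt, THEN spec, of \<C>] by auto
      \<comment> \<open>A nonempty finite subfamily of a chain contains its own union, so a finite
        cover would make the whole space a member of \<open>?A\<close>.\<close>
      have "\<F> \<noteq> {}" using \<F>(3) nonempty_X by auto
      moreover have "subset.chain ?A \<F>"
        using \<C>(2) \<F>(2) unfolding subset_chain_def by (meson subset_iff)
      ultimately have "\<Union>\<F> \<in> ?A" using Union_in_chain[OF \<F>(1)] \<F>(2) sub by blast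
      then show False using \<F>(3) openin_subset[of X "\<Union>\<F>"] by simp
    qed
    moreover have "openin X (\<Union>\<C>)" using sub by (intro openin_Union) blast
    moreover have "act h x \<in> topspace X - \<Union>\<C>" if "h \<in> H" "x \<in> topspace X - \<Union>\<C>" for h x
    proof -
      have "act h x \<in> topspace X - U" if "U \<in> \<C>" for U
        using sub that \<open>h \<in> H\<close> \<open>x \<in> topspace X - \<Union>\<C>\<close> by blast
      then show ?thesis using \<C>(1) by blast
    qed
    ultimately show "\<Union>\<C> \<in> ?A" by simp
  qed
  then obtain M where "M \<in> ?A" and max: "\<And>U. \<lbrakk>U \<in> ?A; M \<subseteq> U\<rbrakk> \<Longrightarrow> U = M" by meson
  then have M: "openin X M" "M \<noteq> topspace X"
    "\<And>h x. \<lbrakk>h \<in> H; x \<in> topspace X - M\<rbrakk> \<Longrightarrow> act h x \<in> topspace X - M" by simp_all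
  \<comment> \<open>The complement of the orbit closure of \<open>y\<close> belongs to
    \<open>?A\<close> and contains \<open>M\<close>, so by maximality it is
    \<open>M\<close>.\<close>
  have oc: "orbit_closure y = topspace X - M" if y: "y \<in> topspace X - M" for y
  proof -
    have yX: "y \<in> topspace X" using y by blast
    have sub: "orbit_closure y \<subseteq> topspace X - M"
      using M(1,3) y by (intro orbit_closure_minimal) auto
    have eq: "topspace X - (topspace X - orbit_closure y) = orbit_closure y"
      using closure_of_subset_topspace by (rule double_diff) simp
    have "topspace X - orbit_closure y \<in> ?A"
    proof (intro CollectI conjI ballI)
      show "openin X (topspace X - orbit_closure y)" by (simp add: openin_diff)
      show "topspace X - orbit_closure y \<noteq> topspace X"
        using self_in_orbit_closure[OF yX] yX by blast
      show "act h x \<in> topspace X - (topspace X - orbit_closure y)"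
        if "h \<in> H" "x \<in> topspace X - (topspace X - orbit_closure y)" for h x
        using orbit_closure_invariant[OF that(1) yX] that(2) unfolding eq .
    qed
    moreover have "M \<subseteq> topspace X - orbit_closure y"
      using sub openin_subset[OF M(1)] by blast
    ultimately have "topspace X - orbit_closure y = M" by (rule max)
    then show ?thesis using eq by simp
  qed
  obtain x where "x \<in> topspace X - M" using M(2) openin_subset[OF M(1)] by blast
  then show ?thesis using oc by (intro bexI[of _ x]) auto
qed

text \<open>The translates of an \<open>H\<close>-minimal set form a closed \<open>T\<close>-invariant set, which by minimality
  is all of \<open>X\<close>; since \<open>H\<close> is normal they are themselves \<open>H\<close>-minimal.\<close>

lemma exists_H_minimal_translates:
  obtains x\<^sub>0 where "x\<^sub>0 \<in> topspace X" "\<And>y. y \<in> orbit_closure x\<^sub>0 \<Longrightarrow> orbit_closure y = orbit_closure x\<^sub>0"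
    "\<And>x. x \<in> topspace X \<Longrightarrow> \<exists>t\<in>carrier G. x \<in> act t ` orbit_closure x\<^sub>0"
proof -
  obtain x0 where x0: "x0 \<in> topspace X" "\<And>y. y \<in> orbit_closure x0 \<Longrightarrow> orbit_closure y = orbit_closure x0"
    using exists_H_minimal by blast
  let ?F = "{act t x |t x. t \<in> carrier G \<and> x \<in> orbit_closure x0}"
  have "closedin X ?F"
    using orbit_closure_invariant[OF _ x0(1)] closedin_topspace[of T]
    by (intro closedin_translates[OF flow_X]) simp_all
  moreover have "(\<lambda>t. act t x0) ` carrier G \<subseteq> ?F"
    using self_in_orbit_closure[OF x0(1)] by blast
  ultimately have "X closure_of ((\<lambda>t. act t x0) ` carrier G) \<subseteq> ?F"
    by (rule closure_of_minimal[rotated])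
  then have "topspace X \<subseteq> ?F"
    using minimal x0(1) by (simp add: minimal_flow_def)
  then have "\<exists>t\<in>carrier G. x \<in> act t ` orbit_closure x0" if "x \<in> topspace X" for x
    using that by blast
  then show thesis using x0 that by blast
qed

text \<open>\<open>x\<close> lies in some translate of the \<open>H\<close>-minimal set, and every
  point of a translate has that translate as its orbit closure. Thus the orbit closures partition
  the space.\<close>

lemma orbit_closure_eq:
  assumes x: "x \<in> topspace X" and y: "y \<in> orbit_closure x"
  shows "orbit_closure y = orbit_closure x"
proof -
  obtain x0 where x0: "x0 \<in> topspace X" "\<And>y. y \<in> orbit_closure x0 \<Longrightarrow> orbit_closure y = orbit_closure x0"
    "\<And>x. x \<in> topspace X \<Longrightarrow> \<exists>t\<in>carrier G. x \<in> act t ` orbit_closure x0"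
    using exists_H_minimal_translates by blast
  have *: "orbit_closure z = act t ` orbit_closure x0"
    if t: "t \<in> carrier G" and z: "z \<in> act t ` orbit_closure x0" for t z
  proof -
    obtain w where w: "w \<in> orbit_closure x0" "z = act t w" using z by blast
    then show ?thesis
      using act_image_orbit_closure[OF t orbit_closure_subset_topspace[OF w(1)]] x0(2)[OF w(1)] by simp
  qed
  obtain t where t: "t \<in> carrier G" "x \<in> act t ` orbit_closure x0" using x0(3)[OF x] by blast
  show ?thesis using *[OF t] *[OF t(1), of y] y by simp
qed

text \<open>With M the \<open>H\<close>-minimal set, the relation is the union of all tM \<times>
  tM. These are the translates of the closed \<open>H\<close>-invariant set M \<times> M in the
  diagonal flow, so \<open>closedin_translates\<close> applies.\<close>

lemma closedin_orbit_closure_rel: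
  "closedin (prod_topology X X)
     {(x, y). x \<in> topspace X \<and> y \<in> topspace X \<and> orbit_closure x = orbit_closure y}"
proof -
  obtain x0 where x0: "x0 \<in> topspace X" "\<And>y. y \<in> orbit_closure x0 \<Longrightarrow> orbit_closure y = orbit_closure x0"
    "\<And>x. x \<in> topspace X \<Longrightarrow> \<exists>t\<in>carrier G. x \<in> act t ` orbit_closure x0"
    using exists_H_minimal_translates by blast
  let ?act = "\<lambda>t (x, y). (act t x, act t y)" and ?M = "orbit_closure x0 \<times> orbit_closure x0"
  have "closedin (prod_topology X X) {?act t p |t p. t \<in> carrier G \<and> p \<in> ?M}"
  proof (rule closedin_translates[OF flow_prod[OF flow_X flow_X]])
    show "closedin (prod_topology X X) ?M" by (simp add: closedin_prod_Times_iff)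
    show "closedin T (carrier G)" using closedin_topspace[of T] by simp
    show "?act h p \<in> ?M" if "h \<in> H" "p \<in> ?M" for h p
      using that orbit_closure_invariant[OF that(1) x0(1)] by auto
  qed simp
  moreover have "{?act t p |t p. t \<in> carrier G \<and> p \<in> ?M} =
      {(x, y). x \<in> topspace X \<and> y \<in> topspace X \<and> orbit_closure x = orbit_closure y}" (is "?L = ?R")
  proof (intro equalityI subsetI)
    fix p assume "p \<in> ?L"
    then obtain t a b where t: "t \<in> carrier G" and ab: "a \<in> orbit_closure x0" "b \<in> orbit_closure x0"
      and p: "p = (act t a, act t b)" by auto
    have abX: "a \<in> topspace X" "b \<in> topspace X"
      using ab orbit_closure_subset_topspace by blast+
    have "orbit_closure (act t a) = orbit_closure (act t b)"
      using act_image_orbit_closure[OF t abX(1)] act_image_orbit_closure[OF t abX(2)]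
        x0(2)[OF ab(1)] x0(2)[OF ab(2)] by simp
    then show "p \<in> ?R" using p abX flow_act_closed[OF flow_X t] by simp
  next
    fix p assume "p \<in> ?R"
    then obtain x y where xy: "p = (x, y)" "x \<in> topspace X" "y \<in> topspace X"
      "orbit_closure x = orbit_closure y" by blast
    obtain t a where t: "t \<in> carrier G" "a \<in> orbit_closure x0" "x = act t a"
      using x0(3)[OF xy(2)] by blast
    have "orbit_closure x = act t ` orbit_closure x0"
      using act_image_orbit_closure[OF t(1) orbit_closure_subset_topspace[OF t(2)]] x0(2)[OF t(2)] t(3)
      by simp
    then have "y \<in> act t ` orbit_closure x0"
      using self_in_orbit_closure[OF xy(3)] xy(4) by simp
    then obtain b where "b \<in> orbit_closure x0" "y = act t b" by blast
    then have "p = ?act t (a, b)" "(a, b) \<in> ?M" using t xy(1) by simp_all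
    then show "p \<in> ?L" using t(1) by blast
  qed
  ultimately show ?thesis by simp
qed

section \<open>The factor X/H\<close>

abbreviation "Z \<equiv> orbit_closure_space X act H"
abbreviation "Zact \<equiv> induced_action X act H"

lemma orbit_closure_rel_image:
  assumes "x \<in> topspace X"
  shows "orbit_closure_rel X act H `` {x} = orbit_closure x"
  using assms orbit_closure_subset_topspace unfolding orbit_closure_rel_def by blast

lemma quotient_map_orbit_closure: "quotient_map X Z orbit_closure"
proof (rule quotient_map_eq)
  show "quotient_map X Z (\<lambda>x. orbit_closure_rel X act H `` {x})"
    unfolding orbit_closure_space_def by (rule quotient_map_quotient_topology)
qed (simp add: orbit_closure_rel_image)

lemma topspace_Z: "topspace Z = orbit_closure ` topspace X"
  using quotient_imp_surjective_map[OF quotient_map_orbit_closure] by simp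

text \<open>The saturation of an open set \<open>U\<close> is the union of its translates under \<open>H\<close>.\<close>

lemma open_map_orbit_closure: "open_map X Z orbit_closure"
  unfolding open_map_def
proof (intro allI impI)
  fix U assume U: "openin X U"
  have U_sub: "U \<subseteq> topspace X" using U by (rule openin_subset)
  have "{x \<in> topspace X. orbit_closure x \<in> orbit_closure ` U} = (\<Union>h\<in>H. act h ` U)"
  proof (intro equalityI subsetI)
    fix x assume "x \<in> {x \<in> topspace X. orbit_closure x \<in> orbit_closure ` U}"
    then obtain u where x: "x \<in> topspace X" "u \<in> U" "orbit_closure x = orbit_closure u" by blast
    \<comment> \<open>\<open>u\<close> lies in the closure of the \<open>H\<close>-orbit of
      \<open>x\<close>, so its neighbourhood \<open>U\<close> contains some
      \<open>act h x\<close>.\<close>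
    then have "u \<in> orbit_closure x" using self_in_orbit_closure[of u] U_sub by auto
    then obtain h where h: "h \<in> H" "act h x \<in> U"
      using x(2) U unfolding in_closure_of by blast
    then have "x = act (inv h) (act h x)" using flow_inv(1)[OF flow_X _ x(1), of h] by simp
    moreover have "inv h \<in> H" using h(1) by simp
    ultimately show "x \<in> (\<Union>h\<in>H. act h ` U)" using h(2) by blast
  next
    fix x assume "x \<in> (\<Union>h\<in>H. act h ` U)"
    then obtain h u where hu: "h \<in> H" "u \<in> U" "x = act h u" by blast
    then have u: "u \<in> topspace X" using U_sub by blast
    have x: "x \<in> orbit_closure u"
      using orbit_closure_invariant[OF hu(1) u self_in_orbit_closure[OF u]] hu(3) by simp
    then show "x \<in> {x \<in> topspace X. orbit_closure x \<in> orbit_closure ` U}"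
      using orbit_closure_eq[OF u x] orbit_closure_subset_topspace[OF x] hu(2) by simp
  qed
  moreover have "openin X (\<Union>h\<in>H. act h ` U)"
  proof (rule openin_Union, clarify)
    fix h assume "h \<in> H"
    then have "open_map X X (act h)"
      using homeomorphic_imp_open_map[OF flow_homeomorphic_map[OF flow_X, of h]] by simp
    then show "openin X (act h ` U)" using U by (simp add: open_map_def)
  qed
  ultimately have "openin X {x \<in> topspace X. orbit_closure x \<in> orbit_closure ` U}" by simp
  moreover have "orbit_closure ` U \<subseteq> topspace Z" unfolding topspace_Z using U_sub by (rule image_mono)
  ultimately show "openin Z (orbit_closure ` U)"
    using quotient_map_orbit_closure[unfolded quotient_map_def, THEN conjunct2, rule_format] by simp
qed

text \<open>The union defining the induced action ranges over equal sets: points of one class have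
  the same orbit closure, and \<open>act t\<close> carries it to one orbit closure.\<close>

lemma induced_action_orbit_closure:
  assumes t: "t \<in> carrier G" and x: "x \<in> topspace X"
  shows "Zact t (orbit_closure x) = orbit_closure (act t x)"
proof -
  have "orbit_closure_rel X act H `` {act t y} = orbit_closure (act t x)"
    if y: "y \<in> orbit_closure x" for y
  proof -
    have yX: "y \<in> topspace X" using y by (rule orbit_closure_subset_topspace)
    have "orbit_closure_rel X act H `` {act t y} = act t ` orbit_closure y"
      using orbit_closure_rel_image[OF flow_act_closed[OF flow_X t yX]]
        act_image_orbit_closure[OF t yX] by simp
    then show ?thesis using orbit_closure_eq[OF x y] act_image_orbit_closure[OF t x] by simp
  qed
  then show ?thesis
    using self_in_orbit_closure[OF x] unfolding induced_action_def by auto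
qed

lemma flow_Z: "flow G T Z Zact"
  using flow_X quotient_map_orbit_closure open_map_orbit_closure
  by (rule flow_quotient) (simp add: induced_action_orbit_closure)

lemma factor_Z: "factor_flow G T X act Z Zact"
  unfolding factor_flow_def
  using flow_X flow_Z quotient_imp_continuous_map[OF quotient_map_orbit_closure]
    topspace_Z induced_action_orbit_closure
  by (intro conjI exI[of _ orbit_closure]) simp_all

lemma compact_Z: "compact_space Z"
  using image_compactin[OF compact_X[unfolded compact_space_def]
      quotient_imp_continuous_map[OF quotient_map_orbit_closure]]
  by (simp add: compact_space_def topspace_Z)

text \<open>The relation is closed, so inequivalent points have open neighbourhoods whose product
  misses it. Their images are disjoint, and they are open because the class map is open.\<close>

lemma Hausdorff_Z: "Hausdorff_space Z"
  unfolding Hausdorff_space_def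
proof (intro allI impI)
  let ?R = "{(x, y). x \<in> topspace X \<and> y \<in> topspace X \<and> orbit_closure x = orbit_closure y}"
  fix a b assume "a \<in> topspace Z \<and> b \<in> topspace Z \<and> a \<noteq> b"
  then obtain x y where xy: "x \<in> topspace X" "y \<in> topspace X" "a = orbit_closure x" "b = orbit_closure y"
    "orbit_closure x \<noteq> orbit_closure y" by (auto simp: topspace_Z)
  have "openin (prod_topology X X) (topspace (prod_topology X X) - ?R)"
    using closedin_orbit_closure_rel by blast
  moreover have "(x, y) \<in> topspace (prod_topology X X) - ?R" using xy by simp
  ultimately obtain U V where UV: "openin X U" "openin X V" "x \<in> U" "y \<in> V"
    "U \<times> V \<subseteq> topspace (prod_topology X X) - ?R"
    unfolding openin_prod_topology_alt by meson
  have "orbit_closure u \<noteq> orbit_closure v" if "u \<in> U" "v \<in> V" for u v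
  proof -
    have "(u, v) \<in> topspace (prod_topology X X) - ?R" using UV(5) that by blast
    then show ?thesis by simp
  qed
  then have "disjnt (orbit_closure ` U) (orbit_closure ` V)"
    unfolding disjnt_def by blast
  moreover have "openin Z (orbit_closure ` U)" "openin Z (orbit_closure ` V)"
    using UV(1,2) open_map_orbit_closure by (simp_all add: open_map_def)
  moreover have "a \<in> orbit_closure ` U" "b \<in> orbit_closure ` V" using UV(3,4) xy(3,4) by simp_all
  ultimately show "\<exists>U V. openin Z U \<and> openin Z V \<and> a \<in> U \<and> b \<in> V \<and> disjnt U V" by blast
qed

text \<open>\<open>H\<close> acts trivially because \<open>act h x\<close> stays in the class of
  \<open>x\<close>. The group acts transitively because every point lies in a translate of the
  \<open>H\<close>-minimal set, so every class is a translate of one base class.\<close>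

lemma almost_periodic_Z: "almost_periodic_flow G T Z Zact"
proof (rule transitive_flow_almost_periodic[OF flow_Z Hausdorff_Z compact_Z])
  fix h z assume h: "h \<in> H" and "z \<in> topspace Z"
  then obtain x where x: "x \<in> topspace X" "z = orbit_closure x" by (auto simp: topspace_Z)
  have "act h x \<in> orbit_closure x"
    using orbit_closure_invariant[OF h x(1) self_in_orbit_closure[OF x(1)]] .
  then have "orbit_closure (act h x) = orbit_closure x" by (rule orbit_closure_eq[OF x(1)])
  then show "Zact h z = z"
    using induced_action_orbit_closure[of h x] h x by simp
next
  fix z assume "z \<in> topspace Z"
  then obtain x where x: "x \<in> topspace X" "z = orbit_closure x" by (auto simp: topspace_Z)
  obtain x0 where x0: "x0 \<in> topspace X" "\<And>y. y \<in> orbit_closure x0 \<Longrightarrow> orbit_closure y = orbit_closure x0"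
    "\<And>x. x \<in> topspace X \<Longrightarrow> \<exists>t\<in>carrier G. x \<in> act t ` orbit_closure x0"
    using exists_H_minimal_translates by blast
  have *: "\<exists>t\<in>carrier G. orbit_closure y = Zact t (orbit_closure x0)" if y: "y \<in> topspace X" for y
  proof -
    obtain t a where t: "t \<in> carrier G" "a \<in> orbit_closure x0" "y = act t a"
      using x0(3)[OF y] by blast
    then show ?thesis
      using induced_action_orbit_closure[OF t(1) orbit_closure_subset_topspace[OF t(2)]] x0(2)[OF t(2)]
      by (intro bexI[of _ t]) simp_all
  qed
  have x0Z: "orbit_closure x0 \<in> topspace Z" using x0(1) by (simp add: topspace_Z)
  obtain s where s: "s \<in> carrier G" "z = Zact s (orbit_closure x0)" using *[OF x(1)] x(2) by blast
  show "topspace Z \<subseteq> (\<lambda>t. Zact t z) ` carrier G"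
  proof
    fix w assume "w \<in> topspace Z"
    then obtain t where t: "t \<in> carrier G" "w = Zact t (orbit_closure x0)"
      using * by (auto simp: topspace_Z)
    \<comment> \<open>If \<open>s\<close> carries the base class to \<open>z\<close> and
      \<open>t\<close> carries it to \<open>w\<close>, then \<open>t \<otimes> inv s\<close> carries
      \<open>z\<close> to \<open>w\<close>.\<close>
    have "Zact (t \<otimes> inv s) z = Zact t (Zact (inv s) z)"
      using flow_mult[OF flow_Z t(1) inv_closed[OF s(1)] \<open>z \<in> topspace Z\<close>] .
    also have "\<dots> = w" using flow_inv(1)[OF flow_Z s(1) x0Z] s(2) t(2) by simp
    finally have "w = Zact (t \<otimes> inv s) z" by simp
    then show "w \<in> (\<lambda>t. Zact t z) ` carrier G"
      using t(1) s(1) by (intro image_eqI[of _ _ "t \<otimes> inv s"]) simp_all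
  qed
qed

text \<open>Each point lies in its own class, so a class that is the only one is the whole space.
  Conversely, nonemptiness guarantees that there is a class at all.\<close>

lemma singleton_iff_orbit_closure:
  "(\<exists>z. topspace Z = {z}) \<longleftrightarrow> (\<forall>x\<in>topspace X. orbit_closure x = topspace X)"
proof
  assume "\<exists>z. topspace Z = {z}"
  then obtain z where z: "\<And>x. x \<in> topspace X \<Longrightarrow> orbit_closure x = z"
    by (auto simp: topspace_Z)
  have "orbit_closure x = topspace X" if x: "x \<in> topspace X" for x
    using closure_of_subset_topspace
  proof (rule equalityI)
    show "topspace X \<subseteq> orbit_closure x"
      using self_in_orbit_closure z x by blast
  qed
  then show "\<forall>x\<in>topspace X. orbit_closure x = topspace X" by blast
next
  assume "\<forall>x\<in>topspace X. orbit_closure x = topspace X"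
  then have "topspace Z = (\<lambda>x. topspace X) ` topspace X"
    unfolding topspace_Z by (intro image_cong) simp_all
  also have "\<dots> = {topspace X}" using nonempty_X by blast
  finally have "topspace Z = {topspace X}" .
  then show "\<exists>z. topspace Z = {z}" by blast
qed

section \<open>Minimality of the product with T/H\<close>

text \<open>The translates of \<open>orbit_closure x \<times> {H}\<close> form a closed set
  containing the orbit of \<open>(x, H)\<close>, hence everything. A translate by \<open>t\<close>
  meets the fibre over \<open>H\<close> only if \<open>t <# H = H\<close>, that is
  \<open>t \<in> H\<close>, and such \<open>t\<close> preserves \<open>orbit_closure x\<close>; so
  this fibre is no larger than \<open>orbit_closure x\<close>.\<close>

lemma minimal_product_imp_orbit_closure:
  assumes min: "minimal_flow G T (prod_topology X (left_coset_space G T H)) (coset_product_action G act)"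
    and x: "x \<in> topspace X"
  shows "orbit_closure x = topspace X"
proof (rule equalityI[OF closure_of_subset_topspace], rule subsetI)
  fix y assume y: "y \<in> topspace X"
  let ?P = "prod_topology X (left_coset_space G T H)" and ?a = "coset_product_action G act"
  let ?F = "{?a t p |t p. t \<in> carrier G \<and> p \<in> orbit_closure x \<times> {H}}"
  have HP: "H \<in> topspace (left_coset_space G T H)"
    using closedin_singleton_coset closedin_subset by blast
  have coset_H: "h <# H = H" if "h \<in> H" for h
    using that by (simp add: coset_join3 subset subgroup_axioms)
  have "closedin ?P ?F"
  proof (rule closedin_translates[OF flow_coset_product[OF flow_X]])
    show "closedin ?P (orbit_closure x \<times> {H})"
      using closedin_singleton_coset by (simp add: closedin_prod_Times_iff)
    show "closedin T (carrier G)" using closedin_topspace[of T] by simp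
    show "?a h p \<in> orbit_closure x \<times> {H}" if "h \<in> H" "p \<in> orbit_closure x \<times> {H}" for h p
      using that orbit_closure_invariant[OF that(1) x] coset_H[OF that(1)]
      by (auto simp: coset_product_action_def)
  qed simp
  moreover have "(\<lambda>t. ?a t (x, H)) ` carrier G \<subseteq> ?F"
    using self_in_orbit_closure[OF x] by blast
  ultimately have "?P closure_of ((\<lambda>t. ?a t (x, H)) ` carrier G) \<subseteq> ?F"
    by (rule closure_of_minimal[rotated])
  moreover have "?P closure_of ((\<lambda>t. ?a t (x, H)) ` carrier G) = topspace ?P"
    using min x HP unfolding minimal_flow_def by simp
  ultimately have "(y, H) \<in> ?F" using y HP by auto
  then obtain t a where t: "t \<in> carrier G" "a \<in> orbit_closure x" "y = act t a" "t <# H = H"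
    by (auto simp: coset_product_action_def)
  have "t \<in> H" 
    using coset_eq_iff[OF t(1) monoid.one_closed[OF monoid_axioms]] lcos_mult_one[OF subset] t(4) by auto
  then show "y \<in> orbit_closure x" using orbit_closure_invariant[OF _ x t(2)] t(3) by simp
qed

text \<open>Over each coset uH the orbit of (x, sH) contains a full \<open>H\<close>-orbit, since by
  normality \<open>H\<close> fixes uH under left multiplication. By hypothesis this slice is dense
  in the fibre.\<close>

lemma orbit_closure_imp_minimal_product:
  assumes oc: "\<And>x. x \<in> topspace X \<Longrightarrow> orbit_closure x = topspace X"
  shows "minimal_flow G T (prod_topology X (left_coset_space G T H)) (coset_product_action G act)"
  unfolding minimal_flow_def
proof (intro conjI ballI)
  let ?P = "prod_topology X (left_coset_space G T H)" and ?a = "coset_product_action G act"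
  show P: "flow G T ?P ?a" using flow_X by (rule flow_coset_product)
  fix p assume p: "p \<in> topspace ?P"
  then obtain x s where x: "x \<in> topspace X" and s: "s \<in> carrier G" and px: "p = (x, s <# H)"
    by (auto simp: topspace_left_coset_space)
  let ?O = "(\<lambda>t. ?a t p) ` carrier G"
  have "(y, u <# H) \<in> ?P closure_of ?O" if y: "y \<in> topspace X" and u: "u \<in> carrier G" for y u
  proof -
    \<comment> \<open>\<open>?r\<close> moves the coset of \<open>s\<close> to the coset of
      \<open>u\<close>, which places the slice in the required fibre.\<close>
    let ?r = "u \<otimes> inv s"
    have r: "?r \<in> carrier G" using u s by simp
    have rs: "?r <# (s <# H) = u <# H" using u s by (simp add: lcos_m_assoc subset m_assoc)
    have rx: "act ?r x \<in> topspace X" using r x by (rule flow_act_closed[OF flow_X])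
    let ?B = "(\<lambda>h. act h (act ?r x)) ` H \<times> {u <# H}"
    have "?B \<subseteq> ?O"
    proof
      fix b assume "b \<in> ?B"
      then obtain h where h: "h \<in> H" "b = (act h (act ?r x), u <# H)" by blast
      have hG: "h \<in> carrier G" using h(1) by simp
      \<comment> \<open>Chosen so that \<open>h \<otimes> u = u \<otimes> ?k\<close>; since
        \<open>?k\<close> lies in \<open>H\<close>, left multiplication by \<open>h\<close> fixes
        the coset of \<open>u\<close>.\<close>
      let ?k = "inv u \<otimes> h \<otimes> u"
      have k: "?k \<in> H" using inv_op_closed1[OF u h(1)] .
      have "h <# (u <# H) = (u \<otimes> ?k) <# H"
        using u hG by (simp add: lcos_m_assoc subset m_assoc[symmetric])
      also have "\<dots> = u <# H" using coset_eq_iff[of "u \<otimes> ?k" u] k u hG by auto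
      finally have "(h \<otimes> ?r) <# (s <# H) = u <# H"
        using lcos_m_assoc[OF l_coset_subset_G[OF subset s] hG r] rs by simp
      then have "b = ?a (h \<otimes> ?r) p"
        using h px flow_mult[OF flow_X hG r x] by (simp add: coset_product_action_def)
      then show "b \<in> ?O" using hG r by (intro image_eqI[of _ _ "h \<otimes> ?r"]) simp_all
    qed
    then have "?P closure_of ?B \<subseteq> ?P closure_of ?O" by (rule closure_of_mono)
    moreover have "?P closure_of ?B = orbit_closure (act ?r x) \<times> (left_coset_space G T H closure_of {u <# H})"
      by (rule closure_of_Times)
    moreover have "y \<in> orbit_closure (act ?r x)" using oc[OF rx] y by simp
    moreover have "u <# H \<in> left_coset_space G T H closure_of {u <# H}"
      using closure_of_subset[of "{u <# H}" "left_coset_space G T H"] u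
      by (simp add: topspace_left_coset_space)
    ultimately show ?thesis by blast
  qed
  then have "topspace ?P \<subseteq> ?P closure_of ?O"
    by (auto simp: topspace_left_coset_space)
  then show "?P closure_of ?O = topspace ?P"
    by (rule equalityI[OF closure_of_subset_topspace])
qed

end

theorem theorem6p8:
  fixes G :: "('g, 'm) monoid_scheme" and T :: "'g topology"
    and X :: "'x topology" and act :: "'g \<Rightarrow> 'x \<Rightarrow> 'x" and H :: "'g set"
  assumes "topological_group G T" and "Hausdorff_space T"
    and "compact_space X" and "Hausdorff_space X" and "topspace X \<noteq> {}"
    and "minimal_flow G T X act"
    and "H \<in> normal_cocompact_closed_subgroups G T"
  shows "(factor_flow G T X act (orbit_closure_space X act H) (induced_action X act H) \<and>
          almost_periodic_flow G T (orbit_closure_space X act H) (induced_action X act H) \<and>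
          \<not> (\<exists>z. topspace (orbit_closure_space X act H) = {z}))
         \<longleftrightarrow>
         \<not> minimal_flow G T (prod_topology X (left_coset_space G T H)) (coset_product_action G act)"
proof -
  have H: "H \<lhd> G" "closedin T H" "compact_space (left_coset_space G T H)"
    using assms(7) by (simp_all add: normal_cocompact_closed_subgroups_def)
  interpret normal H G by (rule H(1))
  interpret minimal_cocompact G T H X act
    by unfold_locales (use assms H in simp_all)
  \<comment> \<open>The quotient is an almost periodic factor in every case, so the left side only
    says that it is not a singleton, that is, that some \<open>H\<close>-orbit closure is
    proper.\<close>
  show ?thesis
    using factor_Z almost_periodic_Z singleton_iff_orbit_closure
      minimal_product_imp_orbit_closure orbit_closure_imp_minimal_product by blast
qed

end
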